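(* Let $H=\bigoplus_{i=1}^m H_i$ be the direct sum of separable real Hilbert spaces $H_1,\dots,H_m$, let $f\colon H\to\mathbb{R}$ be convex and differentiable, let $h_i\colon H_i\to\,]-\infty,+\infty]$ be proper, convex and lower semicontinuous for $i=1,\dots,m$, and set $h(x)=\sum_{i=1}^m h_i(x_i)$ and $F=f+h$. Let $\varepsilon=(\varepsilon_1,\dots,\varepsilon_m)$ be a $\{0,1\}^m$-valued random variable with $p_i:=\mathsf{P}(\varepsilon_i=1)>0$ for every $i$ and $\mathsf{P}(\varepsilon=(0,\dots,0))=0$, and let $(\varepsilon^n)_{n\in\mathbb{N}}$ be a sequence of independent copies of $\varepsilon$. Let $(\nu_i)_{1\le i\le m}\in\,]0,+\infty[^m$ be such that $$(\forall x,v\in H)\quad \mathsf{E}[f(x+\varepsilon\odot v)]\le f(x)+\mathsf{E}[\langle\nabla f(x),\varepsilon\odot v\rangle]+\frac12\sum_{i=1}^m p_i\nu_i\|v_i\|^2 .$$ Let $0<\gamma_i<2/\nu_i$ for every $i$, let $x^0\in\operatorname{dom}h$ be deterministic, and for $n\in\mathbb{N}$ define $$\bar x^{n+1}=\big(\mathrm{prox}_{\gamma_ih_i}(x_i^n-\gamma_i\nabla_if(x^n))\big)_{1\le i\le m},\qquad x^{n+1}=x^n+\varepsilon^n\odot(\bar x^{n+1}-x^n).$$ Set $\delta=\max_{i}\gamma_i\nu_i$ and $p_{\min}=\min_{i}p_i$, and let $\mu,\sigma\ge0$ be moduli of strong convexity of $f$ and $h$, respectively, in the norm $\|\cdot\|_{\Gamma^{-1}}$.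 Then, for every $n\in\mathbb{N}$ and every $x\in\operatorname{dom}F$, $\mathsf{P}$-a.s., $$(1+\sigma)\langle x^n-\bar x^{n+1},x-x^n\rangle_{\Gamma^{-1}}\le\frac1{p_{\min}}\mathsf{E}[F(x^n)-F(x^{n+1})\mid\mathfrak{E}_{n-1}]+\Big(F(x)-F(x^n)-\frac{\mu+\sigma}{2}\|x^n-x\|_{\Gamma^{-1}}^2\Big)+\frac{\delta-2-\sigma}{2}\|x^n-\bar x^{n+1}\|_{\Gamma^{-1}}^2 .$$
   Context: $H=\bigoplus_i H_i$ carries the inner product $\langle x,y\rangle=\sum_{i=1}^m\langle x_i,y_i\rangle$; $\nabla_i f(x)\in H_i$ is the $i$-th component of $\nabla f(x)$. For $v\in H$ and $\epsilon\in\{0,1\}^m$, $\epsilon\odot v=(\epsilon_iv_i)_{1\le i\le m}\in H$. For a proper convex lower semicontinuous function $\varphi$ on a Hilbert space, $\mathrm{prox}_\varphi(x)=\operatorname{argmin}_z\ \varphi(z)+\frac12\|x-z\|^2$. $\mathfrak{E}_{n-1}$ is the sigma-algebra generated by $\varepsilon^0,\dots,\varepsilon^{n-1}$ (the trivial one if $n=0$). The weighted inner product is $\langle x,y\rangle_{\Gamma^{-1}}=\sum_{i=1}^m\frac1{\gamma_i}\langle x_i,y_i\rangle$, with norm $\|\cdot\|_{\Gamma^{-1}}$. That $\mu,\sigma\ge0$ are moduli of strong convexity of $f$ and $h$ in the norm $\|\cdot\|_{\Gamma^{-1}}$ means that for all $x,y\in H$: $f(y)\ge f(x)+\langle\nabla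 f(x),y-x\rangle+\frac{\mu}{2}\|y-x\|_{\Gamma^{-1}}^2$ and, for every $v\in\partial h(x)$ (usual subdifferential), $h(y)\ge h(x)+\langle v,y-x\rangle+\frac{\sigma}{2}\|y-x\|_{\Gamma^{-1}}^2$. *)

theory Defs
  imports "HOL-Probability.Probability"
begin

text \<open>
  The spaces \<open>H i\<close> of a finite family may differ, whereas the components of a vector
  share one type. Each space is therefore a complete separable linear subspace of a common
  inner product space \<open>'a\<close> that is otherwise arbitrary (any finite family of Hilbert spaces is of
  this form up to isometry), and their direct sum is a subspace of \<open>'a ^ 'm\<close>, on
  which the library inner product is the sum of the componentwise ones. Functions on a space \<open>S\<close>
  are functions on the ambient type whose values outside \<open>S\<close> are irrelevant; \<open>S\<close> is passed to
  every notion below that quantifies over the space.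
\<close>

definition separable_hilbert :: "'a::real_inner set \<Rightarrow> bool" where
  "separable_hilbert S \<longleftrightarrow> subspace S \<and> Topological_Spaces.complete S \<and> separable_space (top_of_set S)"

definition hilbert_sum :: "('m::finite \<Rightarrow> 'a::real_inner set) \<Rightarrow> ('a ^ 'm) set" where
  "hilbert_sum H = {x. \<forall>i. x $ i \<in> H i}"

definition proper_on :: "'a set \<Rightarrow> ('a \<Rightarrow> ereal) \<Rightarrow> bool" where
  "proper_on S \<phi> \<longleftrightarrow> (\<forall>x\<in>S. \<phi> x \<noteq> -\<infinity>) \<and> (\<exists>x\<in>S. \<phi> x \<noteq> \<infinity>)"

definition econvex_on :: "'a::real_vector set \<Rightarrow> ('a \<Rightarrow> ereal) \<Rightarrow> bool" where
  "econvex_on S \<phi> \<longleftrightarrow> (\<forall>x\<in>S. \<forall>y\<in>S. \<forall>t\<in>{0<..<1}.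
     \<phi> ((1 - t) *\<^sub>R x + t *\<^sub>R y) \<le> ereal (1 - t) * \<phi> x + ereal t * \<phi> y)"

definition lsc_on :: "'a::topological_space set \<Rightarrow> ('a \<Rightarrow> ereal) \<Rightarrow> bool" where
  "lsc_on S \<phi> \<longleftrightarrow> (\<forall>x\<in>S. \<phi> x \<le> Liminf (at x within S) \<phi>)"

definition domain_on :: "'a set \<Rightarrow> ('a \<Rightarrow> ereal) \<Rightarrow> 'a set" where
  "domain_on S \<phi> = {x\<in>S. \<phi> x < \<infinity>}"

definition subdifferential_on :: "'a::real_inner set \<Rightarrow> ('a \<Rightarrow> ereal) \<Rightarrow> 'a \<Rightarrow> 'a set" where
  "subdifferential_on S \<phi> x = {v\<in>S. \<forall>y\<in>S. \<phi> x + ereal (v \<bullet> (y - x)) \<le> \<phi> y}"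

definition prox_on :: "'a::real_normed_vector set \<Rightarrow> ('a \<Rightarrow> ereal) \<Rightarrow> 'a \<Rightarrow> 'a" where
  "prox_on S \<phi> x = arg_min_on (\<lambda>z. \<phi> z + ereal (1/2 * (norm (x - z))\<^sup>2)) S"

text \<open>On a subspace \<open>S\<close>, the representative of the derivative within \<open>S\<close> is unique
  because it is required to lie in \<open>S\<close>.\<close>

definition gradient_on :: "'a::real_inner set \<Rightarrow> ('a \<Rightarrow> real) \<Rightarrow> 'a \<Rightarrow> 'a" where
  "gradient_on S f x = (THE g. g \<in> S \<and> (f has_derivative (\<lambda>d. g \<bullet> d)) (at x within S))"

definition winner :: "('m::finite \<Rightarrow> real) \<Rightarrow> 'a::real_inner ^ 'm \<Rightarrow> 'a ^ 'm \<Rightarrow> real" where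
  "winner \<gamma> x y = (\<Sum>i\<in>UNIV. 1 / \<gamma> i * (x $ i \<bullet> y $ i))"

definition wnorm :: "('m::finite \<Rightarrow> real) \<Rightarrow> 'a::real_inner ^ 'm \<Rightarrow> real" where
  "wnorm \<gamma> x = sqrt (winner \<gamma> x x)"

definition strong_convexity_modulus_smooth ::
  "('m::finite \<Rightarrow> real) \<Rightarrow> ('a::real_inner ^ 'm) set \<Rightarrow> ('a ^ 'm \<Rightarrow> real) \<Rightarrow> real \<Rightarrow> bool" where
  "strong_convexity_modulus_smooth \<gamma> S f \<mu> \<longleftrightarrow> 0 \<le> \<mu> \<and>
     (\<forall>x\<in>S. \<forall>y\<in>S. f y \<ge> f x + gradient_on S f x \<bullet> (y - x) + \<mu> / 2 * (wnorm \<gamma> (y - x))\<^sup>2)"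

definition strong_convexity_modulus ::
  "('m::finite \<Rightarrow> real) \<Rightarrow> ('a::real_inner ^ 'm) set \<Rightarrow> ('a ^ 'm \<Rightarrow> ereal) \<Rightarrow> real \<Rightarrow> bool" where
  "strong_convexity_modulus \<gamma> S h \<sigma> \<longleftrightarrow> 0 \<le> \<sigma> \<and>
     (\<forall>x\<in>S. \<forall>y\<in>S. \<forall>v\<in>subdifferential_on S h x.
        h y \<ge> h x + ereal (v \<bullet> (y - x)) + ereal (\<sigma> / 2 * (wnorm \<gamma> (y - x))\<^sup>2))"

definition zero_one_vectors :: "(real ^ 'm::finite) set" where
  "zero_one_vectors = {e. \<forall>i. e $ i \<in> {0, 1}}"

definition block_mult :: "real ^ 'm::finite \<Rightarrow> 'a::real_vector ^ 'm \<Rightarrow> 'a ^ 'm"  (infixr "\<odot>" 75)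
  where "e \<odot> v = (\<chi> i. e $ i *\<^sub>R v $ i)"

text \<open>The sigma-algebra generated by \<open>X 0, \<dots>, X (n - 1)\<close>; it is trivial for \<open>n = 0\<close>.\<close>

definition history :: "'w measure \<Rightarrow> 'b measure \<Rightarrow> (nat \<Rightarrow> 'w \<Rightarrow> 'b) \<Rightarrow> nat \<Rightarrow> 'w measure" where
  "history M N X n = sigma (space M) {X k -` A \<inter> space M |k A. k < n \<and> A \<in> sets N}"

end

theory Submission
  imports Defs
begin

text \<open>
  Conditionally on the past the iterate is fixed and the next block selection is an independent copy
  of \<open>eps\<close>, so the conditional expectation is an average over selections. Smoothness bounds
  the expected decrease of \<open>F\<close> below by \<open>\<Sum>i. p i * a i\<close>, where
  \<open>a i = h i (x i) - h i (q i) - \<langle>g i, q i - x i\<rangle> - \<nu> i / 2 * \<parallel>q i - x i\<parallel>\<^sup>2\<close> for the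
  proximal point \<open>q\<close> and the gradient \<open>g\<close> at \<open>x\<close>. The optimality condition of the proximal step and
  \<open>\<gamma> i < 2 / \<nu> i\<close> make each \<open>a i\<close> nonnegative, so the weights may be replaced by
  \<open>pmin\<close>. The claim follows by adding the strong convexity inequality of \<open>f\<close> at \<open>x\<close> and that of
  \<open>h\<close> at \<open>q\<close> with the subgradient \<open>(x - q) / \<gamma> - g\<close>.
\<close>

section \<open>Extended-valued functions: convexity, lower semicontinuity and a lower bound\<close>

lemma econvex_onD_real:
  assumes "econvex_on S \<phi>" "x \<in> S" "y \<in> S" "\<phi> x = ereal a" "\<phi> y = ereal b" "0 \<le> t" "t \<le> 1"
  shows "\<phi> ((1 - t) *\<^sub>R x + t *\<^sub>R y) \<le> ereal ((1 - t) * a + t * b)"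
proof -
  consider "t = 0" | "t = 1" | "t \<in> {0<..<1}" using assms by fastforce
  then show ?thesis
    using assms unfolding econvex_on_def by cases (simp, simp, metis plus_ereal.simps(1) times_ereal.simps(1))
qed

text \<open>If \<open>\<phi> q\<close> exceeded \<open>c\<close>, some level \<open>c'\<close>
  strictly between would lie below \<open>\<phi>\<close> near \<open>q\<close> and above
  \<open>a n\<close> eventually. Bounds by a real sequence allow a converging quadratic term to be
  split off later.\<close>

lemma lsc_on_sequentially:
  assumes lsc: "lsc_on S \<phi>" and q: "q \<in> S" and zS: "\<And>n. z n \<in> S" and zq: "z \<longlonglongrightarrow> q"
    and val: "\<And>n. \<phi> (z n) \<le> ereal (a n)" and a: "a \<longlonglongrightarrow> c"
  shows "\<phi> q \<le> ereal c"
proof (rule ccontr)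
  assume "\<not> \<phi> q \<le> ereal c"
  then obtain c' where c': "ereal c < ereal c'" "ereal c' < \<phi> q"
    using ereal_dense2[of "ereal c" "\<phi> q"] by force
  then have "\<forall>\<^sub>F y in at q within S. ereal c' < \<phi> y"
    using lsc q unfolding lsc_on_def le_Liminf_iff by blast
  \<comment> \<open>The sequence may hit \<open>q\<close> itself, so the punctured filter is
    exchanged for full neighbourhoods; the value at \<open>q\<close> is above \<open>c'\<close>
    too.\<close>
  then have "\<forall>\<^sub>F y in nhds q. y \<in> S \<longrightarrow> ereal c' < \<phi> y"
    unfolding eventually_at_filter by (rule eventually_mono) (use c' in auto)
  then have "\<forall>\<^sub>F n in sequentially. z n \<in> S \<longrightarrow> ereal c' < \<phi> (z n)"
    using zq unfolding filterlim_iff by blast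
  moreover have "\<forall>\<^sub>F n in sequentially. a n < c'"
    using a c' by (auto intro: order_tendstoD)
  ultimately have "\<forall>\<^sub>F n in sequentially. False"
  proof eventually_elim
    case (elim n)
    then show False using zS[of n] val[of n] by (metis ereal_less_eq(3) leD less_imp_le order_le_less_trans order_less_le_trans)
  qed
  then show False by simp
qed

text \<open>The coefficient of \<open>t\<close> yields the variational inequality of a proximal
  point.\<close>

lemma norm_diff_sq_affine:
  fixes u x y :: "'a::real_inner"
  shows "(norm (u - ((1 - t) *\<^sub>R x + t *\<^sub>R y)))\<^sup>2
    = (norm (u - x))\<^sup>2 - 2 * t * ((u - x) \<bullet> (y - x)) + t\<^sup>2 * (norm (y - x))\<^sup>2"
  unfolding power2_norm_eq_inner
  by (simp add: inner_diff_left inner_diff_right inner_add_left inner_add_right inner_commute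
      algebra_simps power2_eq_square)

text \<open>Parallelogram law; the deficit of a quarter of the squared distance makes minimizing
  sequences Cauchy.\<close>

lemma norm_diff_sq_midpoint:
  fixes u x y :: "'a::real_inner"
  shows "(norm (u - ((1 - 1/2) *\<^sub>R x + (1/2) *\<^sub>R y)))\<^sup>2
    = (norm (u - x))\<^sup>2 / 2 + (norm (u - y))\<^sup>2 / 2 - (norm (x - y))\<^sup>2 / 4"
  unfolding power2_norm_eq_inner
  by (simp add: inner_diff_left inner_diff_right inner_add_left inner_add_right inner_commute
      field_simps)

text \<open>Lower semicontinuity bounds \<open>\<phi>\<close> below near a point of the domain, and convexity propagates the
  bound radially; this replaces an affine minorant and so avoids the Hahn--Banach theorem.\<close>

lemma convex_lsc_linear_lower_bound:
  fixes \<phi> :: "'a::real_inner \<Rightarrow> ereal"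
  assumes conv: "convex S" and proper: "proper_on S \<phi>" and ec: "econvex_on S \<phi>" and lsc: "lsc_on S \<phi>"
  shows "\<exists>c\<in>S. \<exists>a. \<exists>b\<ge>0. \<forall>z\<in>S. ereal (a - b * norm (z - c)) \<le> \<phi> z"
proof -
  obtain c where c: "c \<in> S" "\<phi> c \<noteq> \<infinity>" using proper unfolding proper_on_def by auto
  then obtain m where m: "\<phi> c = ereal m"
    using proper unfolding proper_on_def by (cases "\<phi> c") auto
  have "ereal (m - 1) < \<phi> c" by (simp add: m)
  then have "\<forall>\<^sub>F y in at c within S. ereal (m - 1) < \<phi> y"
    using lsc c unfolding lsc_on_def le_Liminf_iff by blast
  then obtain r where r: "r > 0" "\<And>y. y \<in> S \<Longrightarrow> y \<noteq> c \<Longrightarrow> dist y c < r \<Longrightarrow> ereal (m - 1) < \<phi> y"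
    unfolding eventually_at by metis
  have *: "ereal (m - 1 - 2 / r * norm (z - c)) \<le> \<phi> z" if z: "z \<in> S" for z
  proof (cases "norm (z - c) < r")
    case True
    have "ereal (m - 1) \<le> \<phi> z"
    proof (cases "z = c")
      case True
      then show ?thesis by (simp add: m)
    next
      case False
      then show ?thesis
        using \<open>norm (z - c) < r\<close> r(2)[OF z] by (simp add: dist_norm order.strict_implies_order)
    qed
    moreover have "ereal (m - 1 - 2 / r * norm (z - c)) \<le> ereal (m - 1)" using r(1) by simp
    ultimately show ?thesis by (rule order_trans[rotated])
  next
    case False
    \<comment> \<open>Chosen so that \<open>w\<close> lies at distance \<open>r / 2\<close> from
      \<open>c\<close>, inside the ball of the local bound; \<open>1 / t\<close> is then the slope
      \<open>2 / r\<close> times the distance of \<open>z\<close>.\<close>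
    define t where "t = r / 2 / norm (z - c)"
    have nz: "norm (z - c) > 0" using False r(1) by linarith
    have t: "0 < t" "t \<le> 1" using False r(1) nz by (auto simp: t_def field_simps)
    show ?thesis
    proof (cases "\<phi> z")
      case PInf
      then show ?thesis by simp
    next
      case MInf
      then show ?thesis using proper z unfolding proper_on_def by auto
    next
      case (real b)
      define w where "w = (1 - t) *\<^sub>R c + t *\<^sub>R z"
      have wc: "w - c = t *\<^sub>R (z - c)" by (simp add: w_def algebra_simps)
      have "w \<in> S" unfolding w_def using conv c(1) z t by (intro convexD) auto
      moreover have "w \<noteq> c" using wc t nz by auto
      moreover have "dist w c < r"
        unfolding dist_norm wc using t nz r(1) by (simp add: t_def)
      ultimately have "ereal (m - 1) < \<phi> w" by (rule r(2))
      also have "\<phi> w \<le> ereal ((1 - t) * m + t * b)"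
        unfolding w_def using econvex_onD_real[OF ec c(1) z m real] t by simp
      finally have "t * (m - b) < 1" by (simp add: algebra_simps)
      then have "m - b < 1 / t" using t by (simp add: field_simps)
      also have "1 / t = 2 / r * norm (z - c)" by (simp add: t_def)
      finally show ?thesis by (simp add: real)
    qed
  qed
  show ?thesis by (rule bexI[OF _ c(1)], rule exI[of _ "m - 1"], rule exI[of _ "2 / r"]) (use r * in auto)
qed

section \<open>Existence and optimality of proximal points\<close>

text \<open>Direct method without compactness: the quadratic term makes a minimizing sequence
  Cauchy, completeness supplies its limit, and lower semicontinuity makes the limit a
  minimizer.\<close>

lemma prox_exists:
  fixes \<phi> :: "'a::real_inner \<Rightarrow> ereal"
  assumes conv: "convex S" and compl: "Topological_Spaces.complete S"
    and proper: "proper_on S \<phi>" and ec: "econvex_on S \<phi>" and lsc: "lsc_on S \<phi>"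
  obtains q where "is_arg_min (\<lambda>z. \<phi> z + ereal (1/2 * (norm (u - z))\<^sup>2)) (\<lambda>z. z \<in> S) q"
    "\<phi> q \<noteq> \<infinity>"
proof -
  define D where "D = {z \<in> S. \<phi> z \<noteq> \<infinity>}"
  define r where "r z = real_of_ereal (\<phi> z)" for z
  have r: "\<phi> z = ereal (r z)" if "z \<in> D" for z
    using that proper unfolding D_def r_def proper_on_def by (cases "\<phi> z") auto
  define G where "G z = r z + 1/2 * (norm (u - z))\<^sup>2" for z
  obtain a b c where low: "c \<in> S" "0 \<le> b" "\<And>z. z \<in> S \<Longrightarrow> ereal (a - b * norm (z - c)) \<le> \<phi> z"
    using convex_lsc_linear_lower_bound[OF conv proper ec lsc] by metis
  \<comment> \<open>The quadratic term absorbs the linear decrease: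
    \<open>b * s \<le> b\<^sup>2 / 2 + s\<^sup>2 / 2\<close> with
    \<open>s = norm (u - z)\<close>.\<close>
  have lowG: "a - b * norm (u - c) - b\<^sup>2 / 2 \<le> G z" if z: "z \<in> D" for z
  proof -
    have "a - b * norm (z - c) \<le> r z" using low(3)[of z] r[OF z] z by (simp add: D_def)
    moreover have "norm (z - c) \<le> norm (u - c) + norm (u - z)"
      using norm_triangle_ineq4[of "u - c" "u - z"] by simp
    then have "b * norm (z - c) \<le> b * (norm (u - c) + norm (u - z))" using low(2) by (rule mult_left_mono)
    moreover have "0 \<le> (b - norm (u - z))\<^sup>2" by simp
    then have "b * norm (u - z) \<le> b\<^sup>2 / 2 + 1/2 * (norm (u - z))\<^sup>2"
      by (simp add: power2_diff field_simps)
    ultimately show ?thesis unfolding G_def by (simp add: algebra_simps)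
  qed
  have Dne: "D \<noteq> {}" using proper unfolding D_def proper_on_def by auto
  define m where "m = Inf (G ` D)"
  have bdd: "bdd_below (G ` D)" using lowG by (auto intro!: bdd_belowI)
  have mG: "m \<le> G z" if "z \<in> D" for z unfolding m_def using bdd that by (intro cInf_lower) auto
  have "\<exists>z\<in>D. G z < m + 1 / real (Suc n)" for n
    using cInf_lessD[of "G ` D" "m + 1 / real (Suc n)"] Dne unfolding m_def by auto
  then obtain z where z: "\<And>n. z n \<in> D" "\<And>n. G (z n) < m + 1 / real (Suc n)" by metis
  \<comment> \<open>Both points are compared with their midpoint, where \<open>G\<close> is at least
    \<open>m\<close>; the factor 4 stems from the deficit of an eighth of the squared distance in
    \<open>G\<close>.\<close>
  have mid: "(norm (x - y))\<^sup>2 \<le> 4 * (G x - m) + 4 * (G y - m)" if x: "x \<in> D" and y: "y \<in> D" for x y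
  proof -
    define w where "w = (1 - 1/2) *\<^sub>R x + (1/2) *\<^sub>R y"
    have "w \<in> S" unfolding w_def using conv x y by (intro convexD) (auto simp: D_def)
    have le: "\<phi> w \<le> ereal ((1 - 1/2) * r x + 1/2 * r y)"
      unfolding w_def using x y r[OF x] r[OF y] by (intro econvex_onD_real[OF ec]) (auto simp: D_def)
    then have w: "w \<in> D" using \<open>w \<in> S\<close> by (auto simp: D_def)
    then have "r w \<le> r x / 2 + r y / 2" using le r[OF w] by simp
    then have "G w \<le> G x / 2 + G y / 2 - (norm (x - y))\<^sup>2 / 8"
      unfolding G_def w_def norm_diff_sq_midpoint by (simp add: field_simps)
    then show ?thesis using mG[OF w] by simp
  qed
  have "Cauchy z"
  proof (rule metric_CauchyI)
    fix e :: real assume e: "e > 0"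
    \<comment> \<open>Two gaps below \<open>e\<^sup>2 / 8\<close>, each weighted by 4 in
      \<open>mid\<close>, add up to less than \<open>e\<^sup>2\<close>.\<close>
    obtain N where N: "inverse (real (Suc N)) < e\<^sup>2 / 8" using reals_Archimedean[of "e\<^sup>2 / 8"] e by auto
    show "\<exists>M. \<forall>m\<ge>M. \<forall>n\<ge>M. dist (z m) (z n) < e"
    proof (intro exI allI impI)
      fix i j assume ij: "N \<le> i" "N \<le> j"
      have *: "G (z k) - m < e\<^sup>2 / 8" if "N \<le> k" for k
      proof -
        have "1 / real (Suc k) \<le> inverse (real (Suc N))" using that by (simp add: field_simps)
        then show ?thesis using z(2)[of k] N by linarith
      qed
      have "(norm (z i - z j))\<^sup>2 < e\<^sup>2" using mid[OF z(1) z(1), of i j] *[OF ij(1)] *[OF ij(2)] by argo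
      then show "dist (z i) (z j) < e" using e unfolding dist_norm by (simp add: power2_less_imp_less)
    qed
  qed
  then obtain q where q: "q \<in> S" "z \<longlonglongrightarrow> q"
    using compl z(1) unfolding complete_def D_def by blast
  \<comment> \<open>Moving the quadratic term to the other side turns the bounds on
    \<open>G (z n)\<close> into convergent bounds on \<open>\<phi> (z n)\<close> alone.\<close>
  have "(\<lambda>n. m + 1 / real (Suc n) - 1/2 * (norm (u - z n))\<^sup>2) \<longlonglongrightarrow> m + 0 - 1/2 * (norm (u - q))\<^sup>2"
    by (intro tendsto_intros q LIMSEQ_inverse_real_of_nat[unfolded inverse_eq_divide])
  moreover have "\<phi> (z n) \<le> ereal (m + 1 / real (Suc n) - 1/2 * (norm (u - z n))\<^sup>2)" for n
    using z(2)[of n] r[OF z(1), of n] unfolding G_def by simp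
  ultimately have le: "\<phi> q \<le> ereal (m + 0 - 1/2 * (norm (u - q))\<^sup>2)"
    using z(1) by (intro lsc_on_sequentially[OF lsc q(1) _ q(2)]) (auto simp: D_def)
  then have qD: "q \<in> D" using q by (auto simp: D_def)
  have Gq: "G q \<le> m" using le r[OF qD] by (simp add: G_def)
  have "\<phi> q + ereal (1/2 * (norm (u - q))\<^sup>2) \<le> \<phi> y + ereal (1/2 * (norm (u - y))\<^sup>2)" if "y \<in> S" for y
  proof (cases "y \<in> D")
    case True
    then show ?thesis using mG[OF True] Gq r[OF True] r[OF qD] by (simp add: G_def)
  next
    case False
    then show ?thesis using that by (simp add: D_def)
  qed
  then show ?thesis using q qD by (intro that[of q]) (auto simp: is_arg_min_linorder D_def)
qed

text \<open>Optimality is tested along the segment from the proximal point to \<open>y\<close>;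
  dividing by the parameter and letting it tend to 0 removes the second-order term. In effect
  \<open>u - prox_on S \<phi> u\<close> is a subgradient.\<close>

lemma prox_on_variational:
  fixes \<phi> :: "'a::real_inner \<Rightarrow> ereal"
  assumes conv: "convex S" and compl: "Topological_Spaces.complete S"
    and proper: "proper_on S \<phi>" and ec: "econvex_on S \<phi>" and lsc: "lsc_on S \<phi>"
  shows "prox_on S \<phi> u \<in> S" "\<bar>\<phi> (prox_on S \<phi> u)\<bar> \<noteq> \<infinity>"
    "\<And>y. y \<in> S \<Longrightarrow> \<phi> (prox_on S \<phi> u) + ereal ((u - prox_on S \<phi> u) \<bullet> (y - prox_on S \<phi> u)) \<le> \<phi> y"
proof -
  define q where "q = prox_on S \<phi> u"
  define \<Phi> where "\<Phi> = (\<lambda>z. \<phi> z + ereal (1/2 * (norm (u - z))\<^sup>2))"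
  obtain q' where q': "is_arg_min \<Phi> (\<lambda>z. z \<in> S) q'" "\<phi> q' \<noteq> \<infinity>"
    unfolding \<Phi>_def by (rule prox_exists[OF assms])
  \<comment> \<open>\<open>arg_min\<close> is a choice operator, so the chosen point minimizes
    because some minimizer \<open>q'\<close> exists.\<close>
  have "is_arg_min \<Phi> (\<lambda>z. z \<in> S) q"
    unfolding q_def prox_on_def arg_min_on_def arg_min_def \<Phi>_def[symmetric] using q'(1) by (rule someI)
  then have q: "q \<in> S" "\<And>y. y \<in> S \<Longrightarrow> \<Phi> q \<le> \<Phi> y" by (auto simp: is_arg_min_linorder)
  \<comment> \<open>Comparison with \<open>q'\<close>, where \<open>\<phi>\<close> is finite,
    excludes an infinite value at \<open>q\<close>.\<close>
  have "\<Phi> q \<le> \<Phi> q'" using q' q by (auto simp: is_arg_min_linorder)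
  then have "\<phi> q \<noteq> \<infinity>" using q'(2) unfolding \<Phi>_def by auto
  then obtain a where a: "\<phi> q = ereal a"
    using proper q unfolding proper_on_def by (cases "\<phi> q") auto
  have "\<phi> q + ereal ((u - q) \<bullet> (y - q)) \<le> \<phi> y" if y: "y \<in> S" for y
  proof (cases "\<phi> y")
    case PInf
    then show ?thesis by simp
  next
    case MInf
    then show ?thesis using proper y unfolding proper_on_def by auto
  next
    case (real b)
    have *: "a + (u - q) \<bullet> (y - q) - b \<le> t / 2 * (norm (y - q))\<^sup>2" if t: "0 < t" "t < 1" for t
    proof -
      define w where "w = (1 - t) *\<^sub>R q + t *\<^sub>R y"
      have "w \<in> S" unfolding w_def using conv q y t by (intro convexD) auto
      then have "\<Phi> q \<le> \<Phi> w" by (rule q)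
      also have "\<phi> w \<le> ereal ((1 - t) * a + t * b)"
        unfolding w_def using econvex_onD_real[OF ec q(1) y a real] t by simp
      then have "\<Phi> w \<le> ereal ((1 - t) * a + t * b + 1/2 * (norm (u - w))\<^sup>2)"
        unfolding \<Phi>_def 
        using add_right_mono[of "\<phi> w" "ereal ((1 - t) * a + t * b)" "ereal (1/2 * (norm (u - w))\<^sup>2)"] by simp
      finally have "a + 1/2 * (norm (u - q))\<^sup>2 \<le> (1 - t) * a + t * b + 1/2 * (norm (u - w))\<^sup>2"
        by (simp add: \<Phi>_def a)
      then have "t * (a + (u - q) \<bullet> (y - q) - b) \<le> t * (t / 2 * (norm (y - q))\<^sup>2)"
        unfolding w_def norm_diff_sq_affine by (simp add: field_simps power2_eq_square)
      then show ?thesis using t by simp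
    qed
    have "((\<lambda>t. t / 2 * (norm (y - q))\<^sup>2) \<longlongrightarrow> 0 / 2 * (norm (y - q))\<^sup>2) (at_right 0)"
      by (intro tendsto_intros) auto
    moreover have "\<forall>\<^sub>F t in at_right 0. a + (u - q) \<bullet> (y - q) - b \<le> t / 2 * (norm (y - q))\<^sup>2"
      using eventually_at_right_real[of 0 1] by (rule eventually_mono) (use * in auto)
    ultimately have "a + (u - q) \<bullet> (y - q) - b \<le> 0 / 2 * (norm (y - q))\<^sup>2"
      by (rule tendsto_lowerbound) simp
    then show ?thesis by (simp add: a real)
  qed
  then show "prox_on S \<phi> u \<in> S" "\<bar>\<phi> (prox_on S \<phi> u)\<bar> \<noteq> \<infinity>"
    "\<And>y. y \<in> S \<Longrightarrow> \<phi> (prox_on S \<phi> u) + ereal ((u - prox_on S \<phi> u) \<bullet> (y - prox_on S \<phi> u)) \<le> \<phi> y"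
    using q a unfolding q_def by auto
qed

text \<open>The scaled function inherits properness, convexity and lower semicontinuity; its
  variational inequality is then divided by \<open>\<gamma>\<close>.\<close>

lemma prox_on_scaled:
  fixes \<phi> :: "'a::real_inner \<Rightarrow> ereal"
  assumes conv: "convex S" and compl: "Topological_Spaces.complete S"
    and proper: "proper_on S \<phi>" and ec: "econvex_on S \<phi>" and lsc: "lsc_on S \<phi>" and \<gamma>: "0 < \<gamma>"
  defines "q \<equiv> \<lambda>u. prox_on S (\<lambda>z. ereal \<gamma> * \<phi> z) u"
  shows "q u \<in> S" "\<bar>\<phi> (q u)\<bar> \<noteq> \<infinity>"
    "\<And>y. y \<in> S \<Longrightarrow> \<phi> (q u) + ereal (1 / \<gamma> * ((u - q u) \<bullet> (y - q u))) \<le> \<phi> y"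
proof -
  let ?\<psi> = "\<lambda>z. ereal \<gamma> * \<phi> z"
  have p: "proper_on S ?\<psi>" using proper \<gamma> unfolding proper_on_def by auto
  have e: "econvex_on S ?\<psi>"
    unfolding econvex_on_def
  proof (intro ballI)
    fix x y t assume xy: "x \<in> S" "y \<in> S" and t: "t \<in> {0<..<1::real}"
    have "ereal \<gamma> * \<phi> ((1 - t) *\<^sub>R x + t *\<^sub>R y) \<le> ereal \<gamma> * (ereal (1 - t) * \<phi> x + ereal t * \<phi> y)"
      using ec xy t \<gamma> unfolding econvex_on_def by (intro ereal_mult_left_mono) auto
    also have "\<dots> = ereal (1 - t) * (ereal \<gamma> * \<phi> x) + ereal t * (ereal \<gamma> * \<phi> y)"
      using proper xy t \<gamma> unfolding proper_on_def
      by (cases "\<phi> x"; cases "\<phi> y") (auto simp: algebra_simps)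
    finally show "ereal \<gamma> * \<phi> ((1 - t) *\<^sub>R x + t *\<^sub>R y) \<le> \<dots>" .
  qed
  have l: "lsc_on S ?\<psi>"
    unfolding lsc_on_def
  proof
    fix x assume x: "x \<in> S"
    show "ereal \<gamma> * \<phi> x \<le> Liminf (at x within S) ?\<psi>"
    \<comment> \<open>\<open>Liminf_ereal_mult_left\<close> asks for a nontrivial filter; at an
      isolated point, as in the zero space, every lower bound on the \<open>Liminf\<close>
      holds.\<close>
    proof (cases "at x within S = bot")
      case True
      then show ?thesis by (simp add: le_Liminf_iff)
    next
      case False
      then show ?thesis using lsc x \<gamma> unfolding lsc_on_def
        by (subst Liminf_ereal_mult_left) (auto intro!: ereal_mult_left_mono)
    qed
  qed
  note v = prox_on_variational[OF conv compl p e l, where u = u, folded q_def]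
  show "q u \<in> S" by (rule v)
  show fin: "\<bar>\<phi> (q u)\<bar> \<noteq> \<infinity>" using v(2) \<gamma> by (cases "\<phi> (q u)") auto
  fix y assume y: "y \<in> S"
  show "\<phi> (q u) + ereal (1 / \<gamma> * ((u - q u) \<bullet> (y - q u))) \<le> \<phi> y"
    using v(3)[OF y] fin \<gamma> by (cases "\<phi> (q u)"; cases "\<phi> y") (auto simp: field_simps)
qed

section \<open>Riesz representation and the gradient on a complete subspace\<close>

text \<open>The representing vector is the proximal point of \<open>- f'\<close> at the origin.\<close>

lemma Riesz_representation_on:
  fixes f' :: "'a::real_inner \<Rightarrow> real"
  assumes sub: "subspace S" and compl: "Topological_Spaces.complete S" and f': "bounded_linear f'"
  shows "\<exists>g\<in>S. \<forall>d\<in>S. f' d = g \<bullet> d"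
proof -
  let ?\<phi> = "\<lambda>z. ereal (- f' z)"
  interpret bounded_linear f' by fact
  have p: "proper_on S ?\<phi>" using subspace_0[OF sub] unfolding proper_on_def by auto
  have e: "econvex_on S ?\<phi>" unfolding econvex_on_def by (simp add: add scaleR)
  have l: "lsc_on S ?\<phi>" unfolding lsc_on_def
  proof
    fix x
    have "(?\<phi> \<longlongrightarrow> ?\<phi> x) (at x within S)" by (intro tendsto_intros tendsto)
    then show "?\<phi> x \<le> Liminf (at x within S) ?\<phi>"
      unfolding le_Liminf_iff using order_tendstoD(1) by blast
  qed
  define g where "g = prox_on S ?\<phi> 0"
  note v = prox_on_variational[OF subspace_imp_convex[OF sub] compl p e l, where u = 0, folded g_def]
  \<comment> \<open>The variational inequality at \<open>g + d\<close> bounds \<open>f' d\<close>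
    from above by \<open>g \<bullet> d\<close>, and at \<open>g - d\<close> from below.\<close>
  have "f' d = g \<bullet> d" if "d \<in> S" for d
    using v(3)[of "g + d"] v(3)[of "g - d"] that v(1) subspace_add[OF sub] subspace_diff[OF sub]
    by (simp add: add diff)
  then show ?thesis using v(1) by blast
qed

text \<open>\<open>gradient_on\<close> is a definite description, so membership in \<open>S\<close>
  rests on existence and uniqueness. It is what later places the subgradient of the proximal step in
  the space.\<close>

lemma gradient_on_mem:
  fixes f :: "'a::real_inner \<Rightarrow> real"
  assumes sub: "subspace S" and compl: "Topological_Spaces.complete S" and x: "x \<in> S"
    and diff: "f differentiable (at x within S)"
  shows "gradient_on S f x \<in> S"
proof -
  obtain f' where f': "(f has_derivative f') (at x within S)" using diff by (auto simp: differentiable_def)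
  obtain g where g: "g \<in> S" "\<And>d. d \<in> S \<Longrightarrow> f' d = g \<bullet> d"
    using Riesz_representation_on[OF sub compl has_derivative_bounded_linear[OF f']] by blast
  \<comment> \<open>Within \<open>S\<close> only increments \<open>y - x\<close> from the subspace
    matter, and there \<open>f'\<close> agrees with its representative.\<close>
  have gder: "(f has_derivative (\<lambda>d. g \<bullet> d)) (at x within S)"
    unfolding has_derivative_within
  proof
    have "((\<lambda>y. (f y - (f x + f' (y - x))) /\<^sub>R norm (y - x)) \<longlongrightarrow> 0) (at x within S)"
      using f' unfolding has_derivative_within by (simp add: divide_inverse)
    then show "((\<lambda>y. (1 / norm (y - x)) *\<^sub>R (f y - (f x + g \<bullet> (y - x)))) \<longlongrightarrow> 0) (at x within S)"
    proof (rule tendsto_cong[THEN iffD1, rotated])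
      show "\<forall>\<^sub>F y in at x within S. (f y - (f x + f' (y - x))) /\<^sub>R norm (y - x) =
          (1 / norm (y - x)) *\<^sub>R (f y - (f x + g \<bullet> (y - x)))"
        unfolding eventually_at_filter
        by (rule always_eventually) (use g(2) subspace_diff[OF sub _ x] in \<open>auto simp: divide_inverse\<close>)
    qed
  qed (rule bounded_linear_inner_right)
  have uniq: "g' = g" if g': "g' \<in> S" "(f has_derivative (\<lambda>d. g' \<bullet> d)) (at x within S)" for g'
  proof -
    \<comment> \<open>Both candidates are restricted to the line through \<open>x\<close> in
      direction \<open>g' - g\<close>, where a function of one real variable has a single derivative
      at 0.\<close>
    have line: "((\<lambda>t. f (x + t *\<^sub>R (g' - g))) has_derivative (\<lambda>t. k \<bullet> (t *\<^sub>R (g' - g)))) (at (0::real))"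
      if "(f has_derivative (\<lambda>d. k \<bullet> d)) (at x within S)" for k
    proof -
      have d: "((\<lambda>t. x + t *\<^sub>R (g' - g)) has_derivative (\<lambda>t. t *\<^sub>R (g' - g))) (at (0::real))"
        by (auto intro!: derivative_eq_intros)
      have "range (\<lambda>t. x + t *\<^sub>R (g' - g)) \<subseteq> S"
        using x g g' by (auto intro!: subspace_add[OF sub] subspace_scale[OF sub] subspace_diff[OF sub])
      then have "(f has_derivative (\<lambda>d. k \<bullet> d)) (at (x + 0 *\<^sub>R (g' - g)) within range (\<lambda>t. x + t *\<^sub>R (g' - g)))"
        using has_derivative_subset[OF that] by simp
      from has_derivative_in_compose[OF d this] show ?thesis by simp
    qed
    from fun_cong[OF has_derivative_unique[OF line[OF g'(2)] line[OF gder]], of 1]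
    have "(g' - g) \<bullet> (g' - g) = 0" by (simp add: inner_diff_left inner_diff_right)
    then show ?thesis by simp
  qed
  have "\<exists>!g. g \<in> S \<and> (f has_derivative (\<lambda>d. g \<bullet> d)) (at x within S)"
    using g(1) gder uniq by blast
  from theI'[OF this] show ?thesis unfolding gradient_on_def by blast
qed

section \<open>The direct sum and the weighted inner product\<close>

lemma subspace_hilbert_sum:
  assumes "\<And>i. subspace (H i)"
  shows "subspace (hilbert_sum H)"
  using assms unfolding subspace_def hilbert_sum_def by auto

lemma complete_hilbert_sum:
  fixes H :: "'m::finite \<Rightarrow> 'a::real_inner set"
  assumes "\<And>i. Topological_Spaces.complete (H i)"
  shows "Topological_Spaces.complete (hilbert_sum H)"
  unfolding complete_def
proof (intro allI impI)
  fix s :: "nat \<Rightarrow> 'a ^ 'm" assume s: "(\<forall>n. s n \<in> hilbert_sum H) \<and> Cauchy s"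
  have "\<exists>l\<in>H i. (\<lambda>n. s n $ i) \<longlonglongrightarrow> l" for i
    
    using assms[of i, unfolded complete_def, rule_format, of "\<lambda>n. s n $ i"] s Cauchy_vec_nth[of s i]
    by (auto simp: hilbert_sum_def)
  then obtain l where l: "\<And>i. l i \<in> H i" "\<And>i. (\<lambda>n. s n $ i) \<longlonglongrightarrow> l i" by metis
  have "s \<longlonglongrightarrow> (\<chi> i. l i)" by (rule vec_tendstoI) (simp add: l)
  then show "\<exists>l\<in>hilbert_sum H. s \<longlonglongrightarrow> l"
    using l(1) by (intro bexI[of _ "\<chi> i. l i"]) (auto simp: hilbert_sum_def)
qed

lemma winner_diff_left: "winner \<gamma> (x - y) z = winner \<gamma> x z - winner \<gamma> y z"
  unfolding winner_def by (simp add: inner_diff_left right_diff_distrib sum_subtractf)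

lemma winner_commute: "winner \<gamma> x y = winner \<gamma> y x"
  unfolding winner_def by (simp add: inner_commute)

lemma winner_diff_right: "winner \<gamma> z (x - y) = winner \<gamma> z x - winner \<gamma> z y"
  by (metis winner_commute winner_diff_left)

lemma wnorm_sq:
  assumes "\<And>i. 0 < \<gamma> i"
  shows "(wnorm \<gamma> x)\<^sup>2 = winner \<gamma> x x"
proof -
  have "0 \<le> winner \<gamma> x x"
    unfolding winner_def by (intro sum_nonneg mult_nonneg_nonneg) (auto simp: assms less_imp_le)
  then show ?thesis by (simp add: wnorm_def)
qed

section \<open>Deterministic estimate of one proximal step\<close>

text \<open>The three inequalities \<open>descent\<close>, \<open>f\<close> and \<open>h\<close> are
  added, and the gradient terms cancel. In the application \<open>C\<close> is the expected decrease
  divided by \<open>pmin\<close>.\<close>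

lemma proximal_step_inequality:
  fixes x q z g :: "'a::real_inner ^ 'm::finite"
  assumes \<gamma>: "\<And>i. 0 < \<gamma> i" and \<delta>: "\<And>i. \<gamma> i * \<nu> i \<le> \<delta>"
    and descent: "hx - hq - g \<bullet> (q - x) - 1/2 * (\<Sum>i\<in>UNIV. \<nu> i * (norm ((q - x) $ i))\<^sup>2) \<le> C"
    and f: "fx + g \<bullet> (z - x) + \<mu> / 2 * (wnorm \<gamma> (z - x))\<^sup>2 \<le> fz"
    and h: "hq + (\<chi> i. (1 / \<gamma> i) *\<^sub>R (x $ i - \<gamma> i *\<^sub>R g $ i - q $ i)) \<bullet> (z - q)
              + \<sigma> / 2 * (wnorm \<gamma> (z - q))\<^sup>2 \<le> hz"
  shows "(1 + \<sigma>) * winner \<gamma> (x - q) (z - x)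
    \<le> C + (fz + hz - (fx + hx) - (\<mu> + \<sigma>) / 2 * (wnorm \<gamma> (x - z))\<^sup>2)
      + (\<delta> - 2 - \<sigma>) / 2 * (wnorm \<gamma> (x - q))\<^sup>2"
proof -
  have sub: "(\<chi> i. (1 / \<gamma> i) *\<^sub>R (x $ i - \<gamma> i *\<^sub>R g $ i - q $ i)) \<bullet> d = winner \<gamma> (x - q) d - g \<bullet> d" for d
    unfolding inner_vec_def winner_def sum_subtractf[symmetric]
    
  proof (intro sum.cong refl)
    fix i
    show "(\<chi> i. (1 / \<gamma> i) *\<^sub>R (x $ i - \<gamma> i *\<^sub>R g $ i - q $ i)) $ i \<bullet> d $ i
        = 1 / \<gamma> i * ((x - q) $ i \<bullet> d $ i) - g $ i \<bullet> d $ i"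
      using \<gamma>[of i] by (simp add: inner_diff_left diff_divide_distrib)
  qed
  \<comment> \<open>Since \<open>\<nu> i \<le> \<delta> / \<gamma> i\<close>, the smoothness term is
    at most \<open>\<delta>\<close> times the squared weighted norm.\<close>
  have "(\<Sum>i\<in>UNIV. \<nu> i * (norm ((q - x) $ i))\<^sup>2) \<le> (\<Sum>i\<in>UNIV. \<delta> * (1 / \<gamma> i * ((x - q) $ i \<bullet> (x - q) $ i)))"
  proof (rule sum_mono)
    fix i
    have "\<nu> i \<le> \<delta> * (1 / \<gamma> i)" using \<delta>[of i] \<gamma>[of i] by (simp add: field_simps)
    then have "\<nu> i * ((x - q) $ i \<bullet> (x - q) $ i) \<le> \<delta> * (1 / \<gamma> i) * ((x - q) $ i \<bullet> (x - q) $ i)"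
      by (rule mult_right_mono) simp
    then show "\<nu> i * (norm ((q - x) $ i))\<^sup>2 \<le> \<delta> * (1 / \<gamma> i * ((x - q) $ i \<bullet> (x - q) $ i))"
      by (simp add: norm_minus_commute[of "q $ i"] power2_norm_eq_inner)
  qed
  then have \<nu>: "(\<Sum>i\<in>UNIV. \<nu> i * (norm ((q - x) $ i))\<^sup>2) \<le> \<delta> * winner \<gamma> (x - q) (x - q)"
    unfolding winner_def sum_distrib_left .
  have g: "g \<bullet> (z - x) - g \<bullet> (z - q) = g \<bullet> (q - x)" by (simp add: inner_diff_right)
  \<comment> \<open>All terms are re-centred at \<open>x\<close> through
    \<open>z - q = (z - x) + (x - q)\<close>; the cross term of the \<open>\<sigma>\<close> part
    raises the coefficient 1 to \<open>1 + \<sigma>\<close>.\<close>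
  have w: "winner \<gamma> (x - q) (z - q) = winner \<gamma> (x - q) (z - x) + winner \<gamma> (x - q) (x - q)"
    "winner \<gamma> (z - q) (z - q) = winner \<gamma> (x - z) (x - z) + 2 * winner \<gamma> (x - q) (z - x) + winner \<gamma> (x - q) (x - q)"
    "winner \<gamma> (z - x) (z - x) = winner \<gamma> (x - z) (x - z)"
    by (simp_all add: winner_diff_left winner_diff_right winner_commute)
  show ?thesis
    using descent f h \<nu> g unfolding sub wnorm_sq[OF \<gamma>] w by (simp add: field_simps)
qed

section \<open>Random block selections\<close>

lemma zero_one_vectors_component:
  "e \<in> zero_one_vectors \<Longrightarrow> e $ i = indicator {e. e $ i = 1} e"
  unfolding zero_one_vectors_def by (auto simp: indicator_def)

lemma finite_zero_one_vectors: "finite (zero_one_vectors :: (real ^ 'm::finite) set)"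
proof -
  have "zero_one_vectors \<subseteq> range (\<lambda>A. (\<chi> i. indicator A i) :: real ^ 'm)"
  proof
    fix e :: "real ^ 'm" assume e: "e \<in> zero_one_vectors"
    have "e = (\<chi> i. indicator {i. e $ i = 1} i)"
      using e by (auto simp: vec_eq_iff zero_one_vectors_def indicator_def)
    then show "e \<in> range (\<lambda>A. (\<chi> i. indicator A i) :: real ^ 'm)" by blast
  qed
  then show ?thesis by (rule finite_subset) simp
qed

text \<open>The target carries the discrete sigma-algebra, so every \<open>\<phi>\<close> is
  measurable on it, and finiteness of \<open>E\<close> bounds it.\<close>

lemma (in prob_space) integrable_finite_rv:
  fixes \<phi> :: "'b \<Rightarrow> real"
  assumes "X \<in> measurable M (count_space E)" "finite E"
  shows "integrable M (\<lambda>\<omega>. \<phi> (X \<omega>))"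
proof (rule integrable_const_bound[where B = "Max ((\<lambda>e. norm (\<phi> e)) ` E)"])
  show "AE \<omega> in M. norm (\<phi> (X \<omega>)) \<le> Max ((\<lambda>e. norm (\<phi> e)) ` E)"
    using measurable_space[OF assms(1)] assms(2) by (intro AE_I2 Max_ge) auto
  show "(\<lambda>\<omega>. \<phi> (X \<omega>)) \<in> borel_measurable M"
    by (rule measurable_compose[OF assms(1)]) simp
qed

text \<open>In the application \<open>a i\<close> and \<open>b i\<close> are the values of
  \<open>h i\<close> at the old block and at the proximal block, so the integrand is the decrease of
  \<open>F\<close> under the selection.\<close>

lemma expected_block_descent:
  fixes x v g :: "'a::real_inner ^ 'm::finite"
  assumes M: "prob_space M" and eps: "eps \<in> measurable M (count_space zero_one_vectors)"
    and p: "\<And>i. p i = measure M {\<omega> \<in> space M. eps \<omega> $ i = 1}"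
    and pmin: "\<And>i. pmin \<le> p i"
    and smooth: "(\<integral>\<omega>. f (x + eps \<omega> \<odot> v) \<partial>M)
            \<le> f x + (\<integral>\<omega>. g \<bullet> (eps \<omega> \<odot> v) \<partial>M) + 1/2 * (\<Sum>i\<in>UNIV. p i * \<nu> i * (norm (v $ i))\<^sup>2)"
    and sub: "\<And>i. \<nu> i / 2 * (norm (v $ i))\<^sup>2 \<le> a i - b i - g $ i \<bullet> v $ i"
  shows "pmin * ((\<Sum>i\<in>UNIV. a i) - (\<Sum>i\<in>UNIV. b i) - g \<bullet> v - 1/2 * (\<Sum>i\<in>UNIV. \<nu> i * (norm (v $ i))\<^sup>2))
    \<le> (\<integral>\<omega>. f x - f (x + eps \<omega> \<odot> v) - (\<Sum>i\<in>UNIV. eps \<omega> $ i * (b i - a i)) \<partial>M)"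
proof -
  interpret prob_space M by fact
  note int = integrable_finite_rv[OF eps finite_zero_one_vectors]
  have [simp]: "integrable M (\<lambda>\<omega>. f (x + eps \<omega> \<odot> v))" by (rule int)
  have [simp]: "integrable M (\<lambda>\<omega>. eps \<omega> $ i)" for i by (rule int)
  have mean: "(\<integral>\<omega>. eps \<omega> $ i \<partial>M) = p i" for i
  proof -
    have "(\<integral>\<omega>. eps \<omega> $ i \<partial>M) = (\<integral>\<omega>. indicator {\<omega> \<in> space M. eps \<omega> $ i = 1} \<omega> \<partial>M)"
      using zero_one_vectors_component measurable_space[OF eps]
      by (intro Bochner_Integration.integral_cong refl) (fastforce simp: indicator_def)
    also have "\<dots> = p i" unfolding p by (simp add: Int_absorb2 Collect_conj_eq)
    finally show ?thesis .
  qed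
  have g: "g \<bullet> (e \<odot> v) = (\<Sum>i\<in>UNIV. e $ i * (g $ i \<bullet> v $ i))" for e
    by (simp add: inner_vec_def block_mult_def)
  \<comment> \<open>By \<open>sub\<close> every bracket is nonnegative, so lowering its weight from
    \<open>p i\<close> to \<open>pmin\<close> lowers the sum.\<close>
  have "(\<Sum>i\<in>UNIV. pmin * (a i - b i - g $ i \<bullet> v $ i - \<nu> i / 2 * (norm (v $ i))\<^sup>2))
    \<le> (\<Sum>i\<in>UNIV. p i * (a i - b i - g $ i \<bullet> v $ i - \<nu> i / 2 * (norm (v $ i))\<^sup>2))"
    using sub pmin by (intro sum_mono mult_right_mono) auto
  moreover have "(\<integral>\<omega>. f x - f (x + eps \<omega> \<odot> v) - (\<Sum>i\<in>UNIV. eps \<omega> $ i * (b i - a i)) \<partial>M)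
    = f x - (\<integral>\<omega>. f (x + eps \<omega> \<odot> v) \<partial>M) - (\<Sum>i\<in>UNIV. p i * (b i - a i))"
    by (simp add: mean prob_space)
  moreover have "(\<integral>\<omega>. g \<bullet> (eps \<omega> \<odot> v) \<partial>M) = (\<Sum>i\<in>UNIV. p i * (g $ i \<bullet> v $ i))"
    unfolding g by (simp add: mean)
  ultimately show ?thesis
    using smooth
    by (simp add: inner_vec_def sum_distrib_left sum_subtractf sum.distrib algebra_simps sum_divide_distrib)
qed

section \<open>Conditional expectation given the past selections\<close>

lemma space_history: "space (history M N X n) = space M"
  unfolding history_def by (intro space_measure_of) auto

lemma sets_history:
  "sets (history M N X n) = sigma_sets (space M) {X k -` A \<inter> space M |k A. k < n \<and> A \<in> sets N}"
  unfolding history_def by (intro sets_measure_of) auto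

lemma subalgebra_history:
  assumes "\<And>k. X k \<in> measurable M N"
  shows "subalgebra M (history M N X n)"
  unfolding subalgebra_def space_history sets_history
  using assms by (auto intro!: sets.sigma_sets_subset measurable_sets)

lemma measurable_history:
  assumes "X k \<in> measurable M N" "k < n"
  shows "X k \<in> measurable (history M N X n) N"
proof (rule measurableI)
  fix A assume "A \<in> sets N"
  then show "X k -` A \<inter> space (history M N X n) \<in> sets (history M N X n)"
    unfolding space_history sets_history using assms(2) by (intro sigma_sets.Basic) blast
qed (use measurable_space[OF assms(1)] in \<open>auto simp: space_history\<close>)

lemma history_mono:
  assumes "n \<le> n'"
  shows "sets (history M N X n) \<subseteq> sets (history M N X n')"
  unfolding sets_history by (rule sigma_sets_mono') (use assms in fastforce)

text \<open>The indices are grouped into the disjoint blocks \<open>{..<n}\<close> and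
  \<open>{n}\<close>; disjoint groups of an independent family generate independent
  sigma-algebras.\<close>

lemma (in prob_space) indep_history:
  assumes ind: "indep_vars (\<lambda>_. N) X UNIV" and A: "A \<in> sets (history M N X n)" and B: "B \<in> sets N"
  shows "prob (A \<inter> (X n -` B \<inter> space M)) = prob A * prob (X n -` B \<inter> space M)"
proof -
  let ?E = "\<lambda>i. {X i -` A \<inter> space M |A. A \<in> sets N}"
  have "indep_sets (\<lambda>j. sigma_sets (space M) (\<Union>i\<in>case_bool {..<n} {n} j. ?E i)) UNIV"
  proof (rule indep_sets_collect_sigma)
    have "indep_sets ?E UNIV" using ind unfolding indep_vars_def2 by auto
    then show "indep_sets ?E (\<Union>j\<in>UNIV. case_bool {..<n} {n} j)" by (rule indep_sets_mono_index[rotated]) simp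
    show "disjoint_family_on (case_bool {..<n} {n}) UNIV"
      unfolding disjoint_family_on_def by (auto split: bool.split)
    fix i j
    show "Int_stable (?E i)"
    proof (rule Int_stableI)
      fix a b assume "a \<in> ?E i" "b \<in> ?E i"
      then obtain a' b' where "a = X i -` a' \<inter> space M" "b = X i -` b' \<inter> space M" "a' \<in> sets N" "b' \<in> sets N"
        by auto
      then show "a \<inter> b \<in> ?E i" by (intro CollectI exI[of _ "a' \<inter> b'"]) auto
    qed
  qed
  then have "indep_set (sigma_sets (space M) (\<Union>i\<in>{..<n}. ?E i)) (sigma_sets (space M) (?E n))"
    unfolding indep_set_def by (rule indep_sets_cong[THEN iffD1, rotated -1]) (auto split: bool.split)
  moreover have "A \<in> sigma_sets (space M) (\<Union>i\<in>{..<n}. ?E i)"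
    using A unfolding sets_history by (rule back_subst[of "\<lambda>G. A \<in> sigma_sets (space M) G"]) auto
  moreover have "X n -` B \<inter> space M \<in> sigma_sets (space M) (?E n)" using B by auto
  ultimately show ?thesis by (rule indep_setD)
qed

text \<open>Freezing principle: what the past determines is held fixed while the independent
  \<open>X n\<close> is averaged out. Finiteness of \<open>E\<close> reduces it to products of a
  history-measurable factor and an indicator.\<close>

lemma (in prob_space) real_cond_exp_history:
  fixes G :: "'a \<Rightarrow> 'b \<Rightarrow> real"
  assumes ind: "indep_vars (\<lambda>_. count_space E) X UNIV" and E: "finite E"
    and G: "\<And>e. e \<in> E \<Longrightarrow> (\<lambda>\<omega>. G \<omega> e) \<in> borel_measurable (history M (count_space E) X n)"
    and bdd: "\<And>\<omega> e. \<omega> \<in> space M \<Longrightarrow> e \<in> E \<Longrightarrow> \<bar>G \<omega> e\<bar> \<le> B"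
    and Z: "\<And>\<omega>. \<omega> \<in> space M \<Longrightarrow> Z \<omega> = G \<omega> (X n \<omega>)"
  shows "AE \<omega> in M. real_cond_exp M (history M (count_space E) X n) Z \<omega>
    = (\<integral>\<omega>'. G \<omega> (X n \<omega>') \<partial>M)"
proof -
  let ?F = "history M (count_space E) X n"
  have rv: "X k \<in> measurable M (count_space E)" for k using ind unfolding indep_vars_def by auto
  have sub: "subalgebra M ?F" by (rule subalgebra_history[OF rv])
  interpret finite_measure_subalgebra M ?F by standard (rule sub)
  define I where "I e = (indicator (X n -` {e} \<inter> space M) :: 'a \<Rightarrow> real)" for e
  define c where "c e = prob (X n -` {e} \<inter> space M)" for e
  have ev: "X n -` {e} \<inter> space M \<in> events" if "e \<in> E" for e
    using that by (intro measurable_sets[OF rv]) auto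
  have GM: "(\<lambda>\<omega>. G \<omega> e) \<in> borel_measurable M" if "e \<in> E" for e
    using measurable_from_subalg[OF sub G[OF that]] .
  have intI: "integrable M (I e)" if "e \<in> E" for e
    unfolding I_def using ev[OF that] by (simp add: integrable_indicator_iff emeasure_eq_measure)
  \<comment> \<open>Stated for all \<open>e\<close>, also outside \<open>E\<close> where the
    indicator vanishes, because \<open>real_cond_exp_sum\<close> asks for integrability at every
    index.\<close>
  have int: "integrable M (\<lambda>\<omega>. G \<omega> e * I e \<omega>)" for e
  proof (cases "e \<in> E")
    case False
    then have "G \<omega> e * I e \<omega> = 0" if "\<omega> \<in> space M" for \<omega>
      using measurable_space[OF rv that] by (auto simp: I_def indicator_def)
    then show ?thesis by (subst Bochner_Integration.integrable_cong[where g = "\<lambda>_. 0"]) auto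
  next
    case e: True
    show ?thesis
    proof (rule integrable_const_bound[where B = B])
      have "\<bar>G \<omega> e * I e \<omega>\<bar> \<le> B" if "\<omega> \<in> space M" for \<omega>
        using bdd[OF that e] by (auto simp: I_def indicator_def)
      then show "AE \<omega> in M. norm (G \<omega> e * I e \<omega>) \<le> B" by (intro AE_I2) simp
      show "(\<lambda>\<omega>. G \<omega> e * I e \<omega>) \<in> borel_measurable M"
        using GM[OF e] intI[OF e] by (auto intro!: borel_measurable_times)
    qed
  qed
  have decomp: "\<phi> (X n \<omega>) = (\<Sum>e\<in>E. \<phi> e * I e \<omega>)" if "\<omega> \<in> space M" for \<omega> and \<phi> :: "'b \<Rightarrow> real"
  proof -
    have "(\<Sum>e\<in>E. \<phi> e * I e \<omega>) = (\<Sum>e\<in>E. if e = X n \<omega> then \<phi> e else 0)"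
      using that by (intro sum.cong refl) (auto simp: I_def indicator_def)
    also have "\<dots> = \<phi> (X n \<omega>)" using E measurable_space[OF rv that] by simp
    finally show ?thesis by simp
  qed
  have mean: "(\<integral>\<omega>'. G \<omega> (X n \<omega>') \<partial>M) = (\<Sum>e\<in>E. G \<omega> e * c e)" for \<omega>
  proof -
    have "(\<integral>\<omega>'. G \<omega> (X n \<omega>') \<partial>M) = (\<integral>\<omega>'. (\<Sum>e\<in>E. G \<omega> e * I e \<omega>') \<partial>M)"
      by (intro Bochner_Integration.integral_cong refl decomp)
    also have "\<dots> = (\<Sum>e\<in>E. G \<omega> e * c e)"
      using intI ev by (subst Bochner_Integration.integral_sum) (auto simp: I_def c_def Int_absorb2 intro!: sum.cong)
    finally show ?thesis .
  qed
  \<comment> \<open>By independence, conditioning the indicator on the past leaves its constant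
    mean.\<close>
  have "AE \<omega> in M. real_cond_exp M ?F (I e) \<omega> = c e" if e: "e \<in> E" for e
  proof (rule real_cond_exp_charact)
    fix A assume A: "A \<in> sets ?F"
    then have AM: "A \<in> events" using sub unfolding subalgebra_def by auto
    have "(\<integral>\<omega>\<in>A. I e \<omega> \<partial>M) = (\<integral>\<omega>. indicator (A \<inter> (X n -` {e} \<inter> space M)) \<omega> \<partial>M)"
      unfolding set_lebesgue_integral_def I_def by (simp add: indicator_inter_arith)
    also have "\<dots> = prob (A \<inter> (X n -` {e} \<inter> space M))"
      using AM sets.sets_into_space[OF AM] by (simp add: Int_absorb2 Int_assoc)
    also have "\<dots> = prob A * c e"
      unfolding c_def using e by (intro indep_history[OF ind A]) auto
    also have "\<dots> = (\<integral>\<omega>\<in>A. c e \<partial>M)"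
      unfolding set_lebesgue_integral_def using sets.sets_into_space[OF AM] by (simp add: Int_absorb2)
    finally show "(\<integral>\<omega>\<in>A. I e \<omega> \<partial>M) = (\<integral>\<omega>\<in>A. c e \<partial>M)" .
  qed (use intI[OF e] in auto)
  moreover have "AE \<omega> in M. real_cond_exp M ?F (\<lambda>\<omega>. G \<omega> e * I e \<omega>) \<omega> = G \<omega> e * real_cond_exp M ?F (I e) \<omega>"
    if e: "e \<in> E" for e
    using intI[OF e] by (intro real_cond_exp_mult G int e) auto
  ultimately have "AE \<omega> in M. real_cond_exp M ?F (\<lambda>\<omega>. G \<omega> e * I e \<omega>) \<omega> = G \<omega> e * c e"
    if "e \<in> E" for e using that by fastforce
  then have "AE \<omega> in M. \<forall>e\<in>E. real_cond_exp M ?F (\<lambda>\<omega>. G \<omega> e * I e \<omega>) \<omega> = G \<omega> e * c e"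
    by (rule AE_finite_allI[OF E])
  moreover have "AE \<omega> in M. real_cond_exp M ?F (\<lambda>\<omega>. \<Sum>e\<in>E. G \<omega> e * I e \<omega>) \<omega>
      = (\<Sum>e\<in>E. real_cond_exp M ?F (\<lambda>\<omega>. G \<omega> e * I e \<omega>) \<omega>)"
    by (rule real_cond_exp_sum) (rule int)
  moreover have "AE \<omega> in M. real_cond_exp M ?F Z \<omega>
      = real_cond_exp M ?F (\<lambda>\<omega>. \<Sum>e\<in>E. G \<omega> e * I e \<omega>) \<omega>"
  proof (rule real_cond_exp_cong)
    show "AE \<omega> in M. Z \<omega> = (\<Sum>e\<in>E. G \<omega> e * I e \<omega>)" by (intro AE_I2) (simp add: Z decomp)
    show *: "(\<lambda>\<omega>. \<Sum>e\<in>E. G \<omega> e * I e \<omega>) \<in> borel_measurable M"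
      using int by (intro borel_measurable_sum borel_measurable_integrable)
    show "Z \<in> borel_measurable M"
      by (rule measurable_cong[THEN iffD1, OF _ *]) (simp add: Z decomp)
  qed
  ultimately show ?thesis
    unfolding mean by eventually_elim simp
qed

section \<open>The random iteration and its descent inequality\<close>

theorem proposition4p4:
  fixes H :: "'m::finite \<Rightarrow> 'a::real_inner set"
    and f :: "'a ^ 'm \<Rightarrow> real"
    and h :: "'m \<Rightarrow> 'a \<Rightarrow> ereal"
    and hsum F :: "'a ^ 'm \<Rightarrow> ereal"
    and M :: "'w measure"
    and eps :: "'w \<Rightarrow> real ^ 'm"
    and epsn :: "nat \<Rightarrow> 'w \<Rightarrow> real ^ 'm"
    and p \<nu> \<gamma> :: "'m \<Rightarrow> real"
    and x0 :: "'a ^ 'm"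
    and x xbar :: "nat \<Rightarrow> 'w \<Rightarrow> 'a ^ 'm"
    and \<delta> pmin \<mu> \<sigma> :: real
  assumes H: "\<And>i. separable_hilbert (H i)"
    and f_convex: "convex_on (hilbert_sum H) f"
    and f_diff: "f differentiable_on hilbert_sum H"
    and h_proper: "\<And>i. proper_on (H i) (h i)"
    and h_convex: "\<And>i. econvex_on (H i) (h i)"
    and h_lsc: "\<And>i. lsc_on (H i) (h i)"
    and hsum: "\<And>z. hsum z = (\<Sum>i\<in>UNIV. h i (z $ i))"
    and F: "\<And>z. F z = ereal (f z) + hsum z"
    and M: "prob_space M"
    and eps_rv: "eps \<in> measurable M (count_space zero_one_vectors)"
    and p: "\<And>i. p i = measure M {\<omega> \<in> space M. eps \<omega> $ i = 1}"
    and p_pos: "\<And>i. p i > 0"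
    and eps_nonzero: "measure M {\<omega> \<in> space M. eps \<omega> = 0} = 0"
    and epsn_indep: "prob_space.indep_vars M (\<lambda>_. count_space zero_one_vectors) epsn UNIV"
    and epsn_copies: "\<And>n. distr M (count_space zero_one_vectors) (epsn n)
                         = distr M (count_space zero_one_vectors) eps"
    and \<nu>_pos: "\<And>i. \<nu> i > 0"
    and smoothness: "\<And>z v. z \<in> hilbert_sum H \<Longrightarrow> v \<in> hilbert_sum H \<Longrightarrow>
          (\<integral>\<omega>. f (z + eps \<omega> \<odot> v) \<partial>M)
            \<le> f z + (\<integral>\<omega>. gradient_on (hilbert_sum H) f z \<bullet> (eps \<omega> \<odot> v) \<partial>M)
                + 1/2 * (\<Sum>i\<in>UNIV. p i * \<nu> i * (norm (v $ i))\<^sup>2)"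
    and \<gamma>: "\<And>i. 0 < \<gamma> i" "\<And>i. \<gamma> i < 2 / \<nu> i"
    and x0: "x0 \<in> domain_on (hilbert_sum H) hsum"
    and x_0: "\<And>\<omega>. \<omega> \<in> space M \<Longrightarrow> x 0 \<omega> = x0"
    and xbar_Suc: "\<And>n \<omega>. \<omega> \<in> space M \<Longrightarrow>
          xbar (Suc n) \<omega> = (\<chi> i. prox_on (H i) (\<lambda>z. ereal (\<gamma> i) * h i z)
             (x n \<omega> $ i - \<gamma> i *\<^sub>R (gradient_on (hilbert_sum H) f (x n \<omega>) $ i)))"
    and x_Suc: "\<And>n \<omega>. \<omega> \<in> space M \<Longrightarrow>
          x (Suc n) \<omega> = x n \<omega> + epsn n \<omega> \<odot> (xbar (Suc n) \<omega> - x n \<omega>)"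
    and \<delta>: "\<delta> = Max (range (\<lambda>i. \<gamma> i * \<nu> i))"
    and pmin: "pmin = Min (range p)"
    and \<mu>: "strong_convexity_modulus_smooth \<gamma> (hilbert_sum H) f \<mu>"
    and \<sigma>: "strong_convexity_modulus \<gamma> (hilbert_sum H) hsum \<sigma>"
  shows "\<forall>n. \<forall>z \<in> domain_on (hilbert_sum H) F. AE \<omega> in M.
      ereal ((1 + \<sigma>) * winner \<gamma> (x n \<omega> - xbar (Suc n) \<omega>) (z - x n \<omega>))
        \<le> ereal (1 / pmin * real_cond_exp M (history M (count_space zero_one_vectors) epsn n)
                   (\<lambda>\<omega>'. real_of_ereal (F (x n \<omega>') - F (x (Suc n) \<omega>'))) \<omega>)
          + (F z - F (x n \<omega>) - ereal ((\<mu> + \<sigma>) / 2 * (wnorm \<gamma> (x n \<omega> - z))\<^sup>2))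
          + ereal ((\<delta> - 2 - \<sigma>) / 2 * (wnorm \<gamma> (x n \<omega> - xbar (Suc n) \<omega>))\<^sup>2)"
proof (intro allI ballI)
  fix n z assume z: "z \<in> domain_on (hilbert_sum H) F"
  let ?S = "hilbert_sum H" and ?E = "zero_one_vectors :: (real ^ 'm) set"
  interpret prob_space M by fact
  define g where "g = gradient_on ?S f"
  \<comment> \<open>The full proximal gradient step as a deterministic map; randomness enters only
    through the iterate and the selection.\<close>
  define T where "T y = (\<chi> i. prox_on (H i) (\<lambda>z. ereal (\<gamma> i) * h i z) (y $ i - \<gamma> i *\<^sub>R (g y $ i)))" for y
  define D where "D = domain_on ?S hsum"
  define r where "r i w = real_of_ereal (h i w)" for i w
  define R where "R y = (\<Sum>i\<in>UNIV. r i (y $ i))" for y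
  \<comment> \<open>Decrease of \<open>F\<close> from \<open>y\<close> under the selection
    \<open>e\<close>; separating the two arguments allows \<open>y\<close> to be frozen.\<close>
  define \<Psi> where "\<Psi> y e = real_of_ereal (F y - F (y + e \<odot> (T y - y)))" for y e
  have subH: "subspace (H i)" and complH: "Topological_Spaces.complete (H i)" for i
    using H[of i] unfolding separable_hilbert_def by auto
  note convH = subspace_imp_convex[OF subH]
  have subS: "subspace ?S" by (rule subspace_hilbert_sum[OF subH])
  have complS: "Topological_Spaces.complete ?S" by (rule complete_hilbert_sum[OF complH])
  have gS: "g y \<in> ?S" if "y \<in> ?S" for y
    using gradient_on_mem[OF subS complS that] f_diff that unfolding g_def differentiable_on_def by blast
  have DS: "y \<in> ?S" if "y \<in> D" for y using that by (simp add: D_def domain_on_def)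
  \<comment> \<open>Properness excludes minus infinity, so the sum is finite exactly when each block
    is. Exchanging blocks between two points of \<open>D\<close> therefore stays in
    \<open>D\<close>.\<close>
  have D_iff: "y \<in> D \<longleftrightarrow> (\<forall>i. y $ i \<in> H i \<and> \<bar>h i (y $ i)\<bar> \<noteq> \<infinity>)" for y
  proof -
    have "\<bar>h i (y $ i)\<bar> \<noteq> \<infinity> \<longleftrightarrow> h i (y $ i) \<noteq> \<infinity>" if "y $ i \<in> H i" for i
      using h_proper[of i] that unfolding proper_on_def by (cases "h i (y $ i)") auto
    moreover have "y \<in> D \<longleftrightarrow> (\<forall>i. y $ i \<in> H i \<and> h i (y $ i) \<noteq> \<infinity>)"
      unfolding D_def domain_on_def hilbert_sum_def by (auto simp: hsum sum_Pinfty less_top[symmetric] top_ereal_def)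
    ultimately show ?thesis by (simp cong: conj_cong)
  qed
  have r: "h i (y $ i) = ereal (r i (y $ i))" if "y \<in> D" for y i
    using that unfolding D_iff r_def by (simp add: ereal_real')
  have R: "hsum y = ereal (R y)" if "y \<in> D" for y
    unfolding hsum R_def using r[OF that] by simp
  have prox: "T y $ i \<in> H i" "\<bar>h i (T y $ i)\<bar> \<noteq> \<infinity>"
    "\<And>w. w \<in> H i \<Longrightarrow> h i (T y $ i) + ereal (1 / \<gamma> i * ((y $ i - \<gamma> i *\<^sub>R (g y $ i) - T y $ i) \<bullet> (w - T y $ i))) \<le> h i w"
    for y i
    unfolding T_def vec_lambda_beta
    using prox_on_scaled[OF convH complH h_proper h_convex h_lsc \<gamma>(1)] by auto
  have TD: "T y \<in> D" for y using prox by (simp add: D_iff)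
  have comp: "(y + e \<odot> (q - y)) $ i = (if e $ i = 1 then q $ i else y $ i)" if "e \<in> ?E" for e i and y q :: "'a ^ 'm"
    using that by (auto simp: zero_one_vectors_def block_mult_def)
  have stepD: "y + e \<odot> (T y - y) \<in> D" if "y \<in> D" "e \<in> ?E" for y e
    using that(1) TD[of y] unfolding D_iff comp[OF that(2)] by auto
  have \<Psi>: "\<Psi> y e = f y - f (y + e \<odot> (T y - y)) - (\<Sum>i\<in>UNIV. e $ i * (r i (T y $ i) - r i (y $ i)))"
    if y: "y \<in> D" and e: "e \<in> ?E" for y e
  proof -
    have "R y - R (y + e \<odot> (T y - y)) = - (\<Sum>i\<in>UNIV. e $ i * (r i (T y $ i) - r i (y $ i)))"
      unfolding R_def comp[OF e] sum_subtractf[symmetric] sum_negf[symmetric]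
      by (intro sum.cong refl) (use e in \<open>auto simp: zero_one_vectors_def\<close>)
    then show ?thesis unfolding \<Psi>_def F R[OF y] R[OF stepD[OF y e]] by simp
  qed
  have rv: "epsn k \<in> measurable M (count_space ?E)" for k
    using epsn_indep unfolding indep_vars_def by auto
  have step: "x (Suc k) \<omega> = x k \<omega> + epsn k \<omega> \<odot> (T (x k \<omega>) - x k \<omega>)" if "\<omega> \<in> space M" for k \<omega>
    using x_Suc[OF that] xbar_Suc[OF that] by (simp add: T_def g_def)
  have xD: "x k \<omega> \<in> D" if "\<omega> \<in> space M" for k \<omega>
    using measurable_space[OF rv that]
    by (induction k) (auto simp: x_0 that step x0[folded D_def] stepD)
  \<comment> \<open>A deterministic start and finitely many selections leave finitely many values,
    which bounds \<open>\<Psi>\<close> without any regularity of \<open>T\<close>.\<close>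
  have finx: "finite (x k ` space M)" for k
  proof (induction k)
    case 0
    have "x 0 ` space M \<subseteq> {x0}" using x_0 by auto
    then show ?case by (rule finite_subset) simp
  next
    case (Suc k)
    have "x (Suc k) ` space M \<subseteq> (\<lambda>(y, e). y + e \<odot> (T y - y)) ` (x k ` space M \<times> ?E)"
      using measurable_space[OF rv[of k]] by (auto simp: step intro!: rev_image_eqI)
    then show ?case by (rule finite_subset) (use Suc finite_zero_one_vectors in auto)
  qed
  \<comment> \<open>With the discrete sigma-algebra as target, \<open>T\<close> and
    \<open>\<Psi>\<close> can be composed with the iterate freely. \<open>x k\<close> depends only
    on selections with index below \<open>k\<close>.\<close>
  have measx: "x k \<in> measurable (history M (count_space ?E) epsn k) (count_space UNIV)" for k
  proof (induction k)
    case 0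
    have "(\<lambda>_. x0) \<in> measurable (history M (count_space ?E) epsn 0) (count_space UNIV)" by simp
    then show ?case by (rule measurable_cong[THEN iffD1, rotated]) (simp add: space_history x_0)
  next
    case (Suc k)
    let ?h = "history M (count_space ?E) epsn (Suc k)"
    have "x k \<in> measurable ?h (count_space UNIV)"
      using Suc history_mono[of k "Suc k" M "count_space ?E" epsn]
      by (auto simp: measurable_def space_history)
    then have "(\<lambda>\<omega>. x k \<omega> + e \<odot> (T (x k \<omega>) - x k \<omega>)) \<in> measurable ?h (count_space UNIV)" for e
      by (rule measurable_compose) simp
    then have "(\<lambda>\<omega>. x k \<omega> + epsn k \<omega> \<odot> (T (x k \<omega>) - x k \<omega>)) \<in> measurable ?h (count_space UNIV)"
      by (rule measurable_compose_countable'[where g = "epsn k" and I = ?E])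
        (auto intro!: measurable_history rv countable_finite finite_zero_one_vectors)
    then show ?case by (rule measurable_cong[THEN iffD1, rotated]) (simp add: space_history step)
  qed
  let ?C = "real_cond_exp M (history M (count_space ?E) epsn n)
                   (\<lambda>\<omega>'. real_of_ereal (F (x n \<omega>') - F (x (Suc n) \<omega>')))"
  have "AE \<omega> in M. ?C \<omega> = (\<integral>\<omega>'. \<Psi> (x n \<omega>) (epsn n \<omega>') \<partial>M)"
  proof (rule real_cond_exp_history[OF epsn_indep finite_zero_one_vectors])
    show "(\<lambda>\<omega>. \<Psi> (x n \<omega>) e) \<in> borel_measurable (history M (count_space ?E) epsn n)" for e
      by (rule measurable_compose[OF measx]) simp
    show "\<bar>\<Psi> (x n \<omega>) e\<bar> \<le> Max ((\<lambda>(y, e). \<bar>\<Psi> y e\<bar>) ` (x n ` space M \<times> ?E))"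
      if "\<omega> \<in> space M" "e \<in> ?E" for \<omega> e
      using that finx finite_zero_one_vectors by (intro Max_ge) (auto intro!: rev_image_eqI)
  qed (simp add: \<Psi>_def step)
  \<comment> \<open>Equality in law brings the average back to \<open>eps\<close>, the variable of
    the smoothness hypothesis.\<close>
  moreover have "(\<integral>\<omega>'. \<Psi> y (epsn n \<omega>') \<partial>M) = (\<integral>\<omega>'. \<Psi> y (eps \<omega>') \<partial>M)" for y
  proof -
    have "(\<integral>\<omega>'. \<Psi> y (epsn n \<omega>') \<partial>M) = (\<integral>e. \<Psi> y e \<partial>distr M (count_space ?E) (epsn n))"
      by (rule integral_distr[symmetric, OF rv]) simp
    also have "\<dots> = (\<integral>\<omega>'. \<Psi> y (eps \<omega>') \<partial>M)"
      unfolding epsn_copies by (rule integral_distr[OF eps_rv]) simp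
    finally show ?thesis .
  qed
  ultimately have C: "AE \<omega> in M. ?C \<omega> = (\<integral>\<omega>'. \<Psi> (x n \<omega>) (eps \<omega>') \<partial>M)" by simp
  have pmin_le: "pmin \<le> p i" for i unfolding pmin by (intro Min_le) auto
  have "pmin \<in> range p" unfolding pmin by (intro Min_in) auto
  then have pmin_pos: "0 < pmin" using p_pos by auto
  have \<delta>_ge: "\<gamma> i * \<nu> i \<le> \<delta>" for i unfolding \<delta> by (intro Max_ge) auto
  have zD: "z \<in> D" using z unfolding D_def domain_on_def F by auto
  \<comment> \<open>The whole estimate at a fixed point of the domain; the iterate is substituted
    for \<open>y\<close> only at the end.\<close>
  have main: "(1 + \<sigma>) * winner \<gamma> (y - T y) (z - y)
    \<le> 1 / pmin * (\<integral>\<omega>'. \<Psi> y (eps \<omega>') \<partial>M) + (f z + R z - (f y + R y) - (\<mu> + \<sigma>) / 2 * (wnorm \<gamma> (y - z))\<^sup>2)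
      + (\<delta> - 2 - \<sigma>) / 2 * (wnorm \<gamma> (y - T y))\<^sup>2" if y: "y \<in> D" for y
  proof (rule proximal_step_inequality[where \<nu> = \<nu> and g = "g y" and hq = "R (T y)"])
    have yS: "y \<in> ?S" and TS: "T y \<in> ?S" and zS: "z \<in> ?S" using DS y TD zD by auto
    let ?w = "\<chi> i. (1 / \<gamma> i) *\<^sub>R (y $ i - \<gamma> i *\<^sub>R g y $ i - T y $ i)"
    have "pmin * (R y - R (T y) - g y \<bullet> (T y - y) - 1/2 * (\<Sum>i\<in>UNIV. \<nu> i * (norm ((T y - y) $ i))\<^sup>2))
      \<le> (\<integral>\<omega>. f y - f (y + eps \<omega> \<odot> (T y - y)) - (\<Sum>i\<in>UNIV. eps \<omega> $ i * (r i (T y $ i) - r i (y $ i))) \<partial>M)"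
      unfolding R_def
    proof (rule expected_block_descent[OF M eps_rv p pmin_le])
      show "(\<integral>\<omega>. f (y + eps \<omega> \<odot> (T y - y)) \<partial>M) \<le> f y + (\<integral>\<omega>. g y \<bullet> (eps \<omega> \<odot> (T y - y)) \<partial>M)
          + 1/2 * (\<Sum>i\<in>UNIV. p i * \<nu> i * (norm ((T y - y) $ i))\<^sup>2)"
        unfolding g_def by (intro smoothness yS subspace_diff[OF subS TS])
      fix i
      \<comment> \<open>The variational inequality of the block step is tested at the old block
        \<open>y $ i\<close>.\<close>
      have "r i (T y $ i) + 1 / \<gamma> i * ((y $ i - \<gamma> i *\<^sub>R (g y $ i) - T y $ i) \<bullet> (y $ i - T y $ i)) \<le> r i (y $ i)"
        using prox(3)[of "y $ i" i y] y unfolding r[OF y] r[OF TD] by (simp add: D_iff)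
      moreover have "1 / \<gamma> i * ((y $ i - \<gamma> i *\<^sub>R (g y $ i) - T y $ i) \<bullet> (y $ i - T y $ i))
          = 1 / \<gamma> i * (norm ((T y - y) $ i))\<^sup>2 + g y $ i \<bullet> (T y - y) $ i"
        using \<gamma>(1)[of i] unfolding power2_norm_eq_inner
        by (simp add: inner_diff_left inner_diff_right inner_add_right inner_commute field_simps)
      \<comment> \<open>The step size condition in the form
        \<open>\<nu> i / 2 < 1 / \<gamma> i\<close>.\<close>
      moreover have "\<nu> i / 2 * (norm ((T y - y) $ i))\<^sup>2 \<le> 1 / \<gamma> i * (norm ((T y - y) $ i))\<^sup>2"
        using \<gamma>[of i] \<nu>_pos[of i] by (intro mult_right_mono) (auto simp: field_simps)
      ultimately show "\<nu> i / 2 * (norm ((T y - y) $ i))\<^sup>2 \<le> r i (y $ i) - r i (T y $ i) - g y $ i \<bullet> (T y - y) $ i"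
        by linarith
    qed
    also have "\<dots> = (\<integral>\<omega>'. \<Psi> y (eps \<omega>') \<partial>M)"
      using measurable_space[OF eps_rv] by (intro Bochner_Integration.integral_cong refl) (simp add: \<Psi>[OF y])
    finally show "R y - R (T y) - g y \<bullet> (T y - y) - 1/2 * (\<Sum>i\<in>UNIV. \<nu> i * (norm ((T y - y) $ i))\<^sup>2)
        \<le> 1 / pmin * (\<integral>\<omega>'. \<Psi> y (eps \<omega>') \<partial>M)"
      using pmin_pos by (simp add: field_simps)
    show "f y + g y \<bullet> (z - y) + \<mu> / 2 * (wnorm \<gamma> (z - y))\<^sup>2 \<le> f z"
      using \<mu> yS zS unfolding strong_convexity_modulus_smooth_def g_def by blast
    \<comment> \<open>The blockwise optimality conditions add up to a subgradient inequality for the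
      separable sum.\<close>
    have "?w \<in> subdifferential_on ?S hsum (T y)"
      unfolding subdifferential_on_def
    proof (intro CollectI conjI ballI)
      show "?w \<in> ?S" using yS TS gS[OF yS] unfolding hilbert_sum_def
        by (auto intro!: subspace_scale[OF subH] subspace_diff[OF subH])
      fix w assume w: "w \<in> ?S"
      have "hsum (T y) + ereal (?w \<bullet> (w - T y)) = (\<Sum>i\<in>UNIV. h i (T y $ i)
          + ereal (1 / \<gamma> i * ((y $ i - \<gamma> i *\<^sub>R (g y $ i) - T y $ i) \<bullet> (w $ i - T y $ i))))"
        unfolding hsum inner_vec_def sum.distrib by simp
      also have "\<dots> \<le> hsum w"
        unfolding hsum using w by (intro sum_mono prox(3)) (auto simp: hilbert_sum_def)
      finally show "hsum (T y) + ereal (?w \<bullet> (w - T y)) \<le> hsum w" .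
    qed
    then have "hsum (T y) + ereal (?w \<bullet> (z - T y)) + ereal (\<sigma> / 2 * (wnorm \<gamma> (z - T y))\<^sup>2) \<le> hsum z"
      using \<sigma> TS zS unfolding strong_convexity_modulus_def by blast
    then show "R (T y) + ?w \<bullet> (z - T y) + \<sigma> / 2 * (wnorm \<gamma> (z - T y))\<^sup>2 \<le> R z"
      by (simp add: R[OF TD] R[OF zD])
  qed (use \<gamma> \<delta>_ge in auto)
  show "AE \<omega> in M.
      ereal ((1 + \<sigma>) * winner \<gamma> (x n \<omega> - xbar (Suc n) \<omega>) (z - x n \<omega>))
        \<le> ereal (1 / pmin * ?C \<omega>)
          + (F z - F (x n \<omega>) - ereal ((\<mu> + \<sigma>) / 2 * (wnorm \<gamma> (x n \<omega> - z))\<^sup>2))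
          + ereal ((\<delta> - 2 - \<sigma>) / 2 * (wnorm \<gamma> (x n \<omega> - xbar (Suc n) \<omega>))\<^sup>2)"
    using C AE_space
  proof eventually_elim
    case (elim \<omega>)
    have "xbar (Suc n) \<omega> = T (x n \<omega>)" using xbar_Suc[OF elim(2)] by (simp add: T_def g_def)
    then show ?case
      using main[OF xD[OF elim(2), of n]] elim(1) unfolding F R[OF zD] R[OF xD[OF elim(2)]] by simp
  qed
qed

end
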